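(* Consider a traffic network $\mathcal N=(\mathcal R,\mathcal I)$ with destination set $\mathcal D\subseteq\mathcal R$ (as defined in the context), and assume that there exists a path from every node in $\mathcal N$ to at least one node in $\mathcal D$. Suppose that for every allowed movement $(r_i,r_k)$ there is some $\bar t\in[0,T]$ with $s(r_i,r_k,\bar t)\neq0$. Then the average network matrix $A_{\mathrm{av}}=\frac1T\sum_{i=1}^m d_iA_i$ satisfies $$\alpha(A_{\mathrm{av}})<0,$$ where $\alpha(M)=\sup\{\Re(s): s\in\mathbb C,\ \det(sI-M)=0\}$ denotes the spectral abscissa.
   Context: Traffic network. $\mathcal N=(\mathcal R,\mathcal I)$ consists of one-way roads $\mathcal R=\{r_1,\dots,r_{n_r}\}$ (the nodes) and intersections $\mathcal I=\{\mathcal I_1,\dots,\mathcal I_{n_{\mathcal I}}\}$, each $\mathcal I_j\subseteq\mathcal R\times\mathcal R$ being the set of allowed movements, where $(r_i,r_k)\in\mathcal I_j$ denotes movement from $r_k$ into $r_i$. A path from $r_k$ to $r_i$ is a finite sequence of roads starting at $r_k$ and ending at $r_i$ in which each consecutive step is an allowed movement (the trivial path is allowed). Vehicles enter at source roads $\mathcal S\subseteq\mathcal R$ and exit at destination roads $\mathcal D\subseteq\mathcal R$, with $\mathcal S\cap\mathcal D=\varnothing$. Road $r_i$ has length $\ell_i>0$ and is discretized into $\sigma_i=\lceil\ell_i/h\rceil$ cells, with $h>0$ a fixed discretization step; $\gamma_i>0$ is the average speed on $r_i$, and $n=\sum_{i=1}^{n_r}\sigma_i$. Green split functions $s(r_i,r_k,t)\in\{0,1\}$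 are $T$-periodic in $t$ ($T>0$), piecewise constant, with half-open constancy intervals $[t_j,t_{j+1})$, and $s(r_i,r_k,\cdot)\equiv0$ if $(r_i,r_k)$ is not an allowed movement. The outflow-rate parameter satisfies $c(r_i,r_k)>0$ for every allowed movement $(r_i,r_k)$. The exogenous outflow rates satisfy $\bar w_{r_i}\in[0,1]$, with $\bar w_{r_i}\ne0$ if and only if $r_i\in\mathcal D$. Network matrix. $A=A(t)\in\mathbb{R}^{n\times n}$ has blocks $A_{ik}\in\mathbb R^{\sigma_i\times\sigma_k}$, $i,k\in\{1,\dots,n_r\}$: $$A_{ik}=s(r_i,r_k,t)\,c(r_i,r_k)\,e_1e_{\sigma_k}^{\mathsf T}\ (i\ne k),\qquad A_{ii}=D_i-\Big(\sum_{\ell}s(r_\ell,r_i,t)\,c(r_\ell,r_i)+\bar w_{r_i}\Big)e_{\sigma_i}e_{\sigma_i}^{\mathsf T},$$ where $e_j$ denotes the $j$-th canonical vector of the appropriate dimension, the sum is over roads $r_\ell\neq r_i$ (no road has a movement into itself), and $D_i\in\mathbb R^{\sigma_i\times\sigma_i}$ equals $\gamma_i/h$ times the matrix with diagonal $(-1,\dots,-1,0)$, all subdiagonal entries equal to $1$, and zeros elsewhere. Modes and average matrix. Let $0=\tau_0<\tau_1<\dots<\tau_m=T$ be the instants in one period at which some green split function changes value. $A(t)$ is constant between consecutive instants $\tau_{i-1}$ and $\tau_i$; this constant matrix is the $i$-th network mode $A_i$, its duration is $d_i=\tau_i-\tau_{i-1}>0$, and $A_{\mathrm{av}}=\frac1T\sum_{i=1}^m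 d_iA_i$. *)

theory Defs
  imports Complex_Main "Jordan_Normal_Form.Matrix" "Jordan_Normal_Form.Determinant"
begin

text \<open>
  Roads are identified with their indices, counted from 0: road \<open>i\<close> is a number
  \<open>i < num_roads N\<close>. In all binary data (movements, \<open>split\<close>, \<open>rate\<close>) the pair \<open>(i, k)\<close> stands
  for the movement from road \<open>k\<close> into road \<open>i\<close>. Cells are likewise counted from 0, so the
  canonical vectors $e_1$ and $e_\sigma$ are \<open>unit_vec \<sigma> 0\<close> and \<open>unit_vec \<sigma> (\<sigma> - 1)\<close>.
\<close>

record traffic_net =
  num_roads :: nat
  intersections :: "(nat \<times> nat) set set"
  sources :: "nat set"
  dests :: "nat set"
  len :: "nat \<Rightarrow> real"
  step :: real
  speed :: "nat \<Rightarrow> real"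
  period :: real
  split :: "nat \<Rightarrow> nat \<Rightarrow> real \<Rightarrow> real"
  rate :: "nat \<Rightarrow> nat \<Rightarrow> real"
  exit_rate :: "nat \<Rightarrow> real"

definition roads :: "traffic_net \<Rightarrow> nat set" where
  "roads N = {..<num_roads N}"

definition movements :: "traffic_net \<Rightarrow> (nat \<times> nat) set" where
  "movements N = \<Union> (intersections N)"

definition piecewise_constant :: "real \<Rightarrow> (real \<Rightarrow> real) \<Rightarrow> bool" where
  "piecewise_constant T f \<longleftrightarrow>
     (\<exists>(t :: nat \<Rightarrow> real) p. t 0 = 0 \<and> t p = T \<and> (\<forall>j<p. t j < t (Suc j)) \<and>
        (\<forall>j<p. \<forall>u\<in>{t j..<t (Suc j)}. f u = f (t j)))"

definition traffic_network :: "traffic_net \<Rightarrow> bool" where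
  "traffic_network N \<longleftrightarrow>
     num_roads N \<ge> 1 \<and>
     (\<forall>J\<in>intersections N. J \<subseteq> roads N \<times> roads N) \<and>
     (\<forall>i\<in>roads N. (i, i) \<notin> movements N) \<and>
     sources N \<subseteq> roads N \<and> dests N \<subseteq> roads N \<and> sources N \<inter> dests N = {} \<and>
     step N > 0 \<and> (\<forall>i\<in>roads N. len N i > 0) \<and> (\<forall>i\<in>roads N. speed N i > 0) \<and>
     period N > 0 \<and>
     (\<forall>i\<in>roads N. \<forall>k\<in>roads N.
        (\<forall>t. split N i k t \<in> {0, 1}) \<and>
        (\<forall>t. split N i k (t + period N) = split N i k t) \<and>
        piecewise_constant (period N) (split N i k) \<and>
        ((i, k) \<notin> movements N \<longrightarrow> (\<forall>t. split N i k t = 0))) \<and>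
     (\<forall>(i, k)\<in>movements N. rate N i k > 0) \<and>
     (\<forall>i\<in>roads N. 0 \<le> exit_rate N i \<and> exit_rate N i \<le> 1 \<and>
        (exit_rate N i \<noteq> 0 \<longleftrightarrow> i \<in> dests N))"

definition is_path :: "traffic_net \<Rightarrow> nat \<Rightarrow> nat list \<Rightarrow> nat \<Rightarrow> bool" where
  "is_path N k xs i \<longleftrightarrow>
     xs \<noteq> [] \<and> set xs \<subseteq> roads N \<and> hd xs = k \<and> last xs = i \<and>
     (\<forall>j. Suc j < length xs \<longrightarrow> (xs ! Suc j, xs ! j) \<in> movements N)"

definition cells :: "traffic_net \<Rightarrow> nat \<Rightarrow> nat" where
  "cells N i = nat \<lceil>len N i / step N\<rceil>"

definition net_dim :: "traffic_net \<Rightarrow> nat" where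
  "net_dim N = (\<Sum>i<num_roads N. cells N i)"

definition outer :: "real vec \<Rightarrow> real vec \<Rightarrow> real mat" where
  "outer u v = mat (dim_vec u) (dim_vec v) (\<lambda>(a, b). u $ a * v $ b)"

definition shift_block :: "traffic_net \<Rightarrow> nat \<Rightarrow> real mat" where
  "shift_block N i = (speed N i / step N) \<cdot>\<^sub>m
     mat (cells N i) (cells N i)
       (\<lambda>(a, b). if a = b then (if a = cells N i - 1 then 0 else - 1)
                 else if a = b + 1 then 1 else 0)"

definition net_block :: "traffic_net \<Rightarrow> real \<Rightarrow> nat \<Rightarrow> nat \<Rightarrow> real mat" where
  "net_block N t i k =
     (if i \<noteq> k then
        (split N i k t * rate N i k) \<cdot>\<^sub>m
          outer (unit_vec (cells N i) 0) (unit_vec (cells N k) (cells N k - 1))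
      else
        shift_block N i -
        ((\<Sum>l\<in>roads N - {i}. split N l i t * rate N l i) + exit_rate N i) \<cdot>\<^sub>m
          outer (unit_vec (cells N i) (cells N i - 1)) (unit_vec (cells N i) (cells N i - 1)))"

text \<open>
  Rows and columns \<open>p < net_dim N\<close> of the assembled matrix list the cells road after road:
  \<open>p\<close> is cell \<open>cell_of N p\<close> of road \<open>road_of N p\<close>.
\<close>

definition offset :: "traffic_net \<Rightarrow> nat \<Rightarrow> nat" where
  "offset N i = (\<Sum>k<i. cells N k)"

definition road_of :: "traffic_net \<Rightarrow> nat \<Rightarrow> nat" where
  "road_of N p = (THE i. i < num_roads N \<and> offset N i \<le> p \<and> p < offset N i + cells N i)"

definition cell_of :: "traffic_net \<Rightarrow> nat \<Rightarrow> nat" where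
  "cell_of N p = p - offset N (road_of N p)"

lemma cell_layout:
  assumes "i < num_roads N" "a < cells N i"
  shows "road_of N (offset N i + a) = i" "cell_of N (offset N i + a) = a" "offset N i + a < net_dim N"
proof -
  have mono: "offset N x + cells N x \<le> offset N y" if "x < y" for x y
    using sum_mono2[of "{..<y}" "{..<Suc x}" "cells N"] that by (auto simp: offset_def)
  show *: "road_of N (offset N i + a) = i"
    unfolding road_of_def
  proof (rule the_equality)
    fix k assume "k < num_roads N \<and> offset N k \<le> offset N i + a \<and> offset N i + a < offset N k + cells N k"
    then show "k = i" using mono[of i k] mono[of k i] assms by (cases k i rule: linorder_cases) auto
  qed (use assms in auto)
  show "cell_of N (offset N i + a) = a" by (simp add: cell_of_def *)
  show "offset N i + a < net_dim N" using mono[of i "num_roads N"] assms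
    by (auto simp: offset_def net_dim_def)
qed

definition net_matrix :: "traffic_net \<Rightarrow> real \<Rightarrow> real mat" where
  "net_matrix N t = mat (net_dim N) (net_dim N)
     (\<lambda>(p, q). net_block N t (road_of N p) (road_of N q) $$ (cell_of N p, cell_of N q))"

definition changes_at :: "(real \<Rightarrow> real) \<Rightarrow> real \<Rightarrow> bool" where
  "changes_at f t \<longleftrightarrow> \<not> (\<forall>\<^sub>F u in at t. f u = f t)"

text \<open>
  The endpoints \<open>0\<close> and \<open>T\<close> of the period always belong to the list, whether or not a green
  split changes value there.
\<close>

definition switching_instants :: "traffic_net \<Rightarrow> (nat \<Rightarrow> real) \<Rightarrow> nat \<Rightarrow> bool" where
  "switching_instants N \<tau> m \<longleftrightarrow>
     \<tau> 0 = 0 \<and> \<tau> m = period N \<and> (\<forall>j<m. \<tau> j < \<tau> (Suc j)) \<and>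
     \<tau> ` {1..<m} = {t \<in> {0<..<period N}. \<exists>i\<in>roads N. \<exists>k\<in>roads N. changes_at (split N i k) t}"

lemma finite_changes:
  assumes "piecewise_constant T f"
  shows "finite {t \<in> {0<..<T}. changes_at f t}"
proof -
  obtain t :: "nat \<Rightarrow> real" and p where t0: "t 0 = 0" and tp: "t p = T"
    and const: "\<forall>j<p. \<forall>u\<in>{t j..<t (Suc j)}. f u = f (t j)"
    using assms unfolding piecewise_constant_def by blast
  have "x \<in> t ` {..p}" if x: "0 < x" "x < T" "changes_at f x" for x
  proof (rule ccontr)
    assume nx: "x \<notin> t ` {..p}"
    define K where "K = {j. j \<le> p \<and> t j \<le> x}"
    define j where "j = Max K"
    have fin: "finite K" by (simp add: K_def)
    have "0 \<in> K" using x(1) t0 by (simp add: K_def)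
    then have "j \<in> K" using Max_in[OF fin] unfolding j_def by blast
    then have j: "j \<le> p" "t j \<le> x" by (simp_all add: K_def)
    have "j \<noteq> p" using j(2) x(2) tp by (metis not_le)
    then have jp: "j < p" using j(1) by simp
    have "Suc j \<notin> K" using Max_ge[OF fin, of "Suc j"] unfolding j_def[symmetric] by linarith
    then have b2: "x < t (Suc j)" using jp by (simp add: K_def)
    have "t j \<noteq> x" using nx j(1) by blast
    then have b1: "t j < x" using j(2) by simp
    have eq: "f u = f x" if "u \<in> {t j<..<t (Suc j)}" for u
    proof -
      have "u \<in> {t j..<t (Suc j)}" "x \<in> {t j..<t (Suc j)}" using that b1 b2 by simp_all
      then show ?thesis using const jp by metis
    qed
    have "\<forall>\<^sub>F u in at x. u \<in> {t j<..<t (Suc j)}"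
      by (rule eventually_at_in_open') (use b1 b2 in simp_all)
    then have "\<forall>\<^sub>F u in at x. f u = f x" by (rule eventually_mono) (rule eq)
    then show False using x(3) by (simp add: changes_at_def)
  qed
  then have "{t \<in> {0<..<T}. changes_at f t} \<subseteq> t ` {..p}" by auto
  then show ?thesis by (rule finite_surj[rotated]) simp
qed

lemma switching_instants_exist:
  assumes "traffic_network N"
  shows "\<exists>\<tau> m. switching_instants N \<tau> m"
proof -
  define C where "C = {t \<in> {0<..<period N}. \<exists>i\<in>roads N. \<exists>k\<in>roads N. changes_at (split N i k) t}"
  have T: "period N > 0" using assms by (simp add: traffic_network_def)
  have "C = (\<Union>i\<in>roads N. \<Union>k\<in>roads N. {t \<in> {0<..<period N}. changes_at (split N i k) t})"
    unfolding C_def by auto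
  also have "finite \<dots>"
  proof (intro finite_UN_I finite_changes)
    show "finite (roads N)" "finite (roads N)" by (simp_all add: roads_def)
    fix i k assume "i \<in> roads N" "k \<in> roads N"
    then show "piecewise_constant (period N) (split N i k)"
      using assms unfolding traffic_network_def by blast
  qed
  finally have fin: "finite C" .
  define L where "L = 0 # sorted_list_of_set C @ [period N]"
  define m where "m = Suc (card C)"
  have set: "set (sorted_list_of_set C) = C" and len: "length (sorted_list_of_set C) = card C"
    using fin by auto
  have Cb: "0 < x \<and> x < period N" if "x \<in> C" for x using that by (auto simp: C_def)
  have sw: "sorted_wrt (<) L"
    unfolding L_def using T Cb fin
    by (auto simp: sorted_wrt_append)
  have st: "L ! j < L ! Suc j" if "j < m" for j
    by (rule sorted_wrt_nth_less[OF sw]) (use that len in \<open>simp_all add: L_def m_def\<close>)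
  have "(!) L ` {1..<m} = (!) (sorted_list_of_set C) ` {..<card C}"
  proof -
    have "{1..<m} = Suc ` {..<card C}"
      unfolding m_def lessThan_atLeast0 image_Suc_atLeastLessThan by simp
    then have "(!) L ` {1..<m} = (\<lambda>j. L ! Suc j) ` {..<card C}"
      by (simp only: image_image)
    also have "\<dots> = (!) (sorted_list_of_set C) ` {..<card C}"
      by (rule image_cong) (simp_all add: L_def nth_append len)
    finally show ?thesis .
  qed
  also have "\<dots> = C"
    using nth_image[of "card C" "sorted_list_of_set C"] by (simp add: set len lessThan_atLeast0)
  finally have img: "(!) L ` {1..<m} = C" .
  have ends: "L ! 0 = 0" "L ! m = period N"
    by (simp_all add: L_def m_def nth_append len)
  have "switching_instants N ((!) L) m"
    unfolding switching_instants_def C_def[symmetric] using st ends img by simp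
  then show ?thesis by (intro exI)
qed

text \<open>
  Since constancy intervals are closed on the left, the constant value of the network matrix
  between \<open>\<tau> (i - 1)\<close> and \<open>\<tau> i\<close> is the one at \<open>\<tau> (i - 1)\<close>; modes are numbered \<open>1, \<dots>, m\<close>.
\<close>

definition mode :: "traffic_net \<Rightarrow> (nat \<Rightarrow> real) \<Rightarrow> nat \<Rightarrow> real mat" where
  "mode N \<tau> i = net_matrix N (\<tau> (i - 1))"

definition duration :: "(nat \<Rightarrow> real) \<Rightarrow> nat \<Rightarrow> real" where
  "duration \<tau> i = \<tau> i - \<tau> (i - 1)"

text \<open>The weighted sum of matrices is taken entrywise.\<close>

definition avg_matrix :: "traffic_net \<Rightarrow> (nat \<Rightarrow> real) \<Rightarrow> nat \<Rightarrow> real mat" where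
  "avg_matrix N \<tau> m = (1 / period N) \<cdot>\<^sub>m
     mat (net_dim N) (net_dim N) (\<lambda>pq. \<Sum>i=1..m. duration \<tau> i * mode N \<tau> i $$ pq)"

definition spectral_abscissa :: "real mat \<Rightarrow> real" where
  "spectral_abscissa M =
     Sup {Re z | z. det (z \<cdot>\<^sub>m 1\<^sub>m (dim_row M) - map_mat complex_of_real M) = 0}"

end

theory Submission
  imports Defs "Jordan_Normal_Form.Spectral_Radius"
begin

text \<open>
  The average matrix is Metzler with nonpositive column sums, and a column sum is negative at the
  last cell of a destination road. For a left eigenvector \<open>w\<close> of an eigenvalue \<open>z\<close> with
  \<open>Re z \<ge> 0\<close>, comparing moduli in the equation at an index \<open>q\<close> where \<open>\<bar>w q\<bar>\<close> is maximal shows that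
  the column sum at \<open>q\<close> vanishes and that \<open>\<bar>w\<bar>\<close> is maximal at every \<open>p\<close> with a positive entry
  \<open>(p, q)\<close>. Following the positive entries along the cells of a path to a destination contradicts
  the negative column sum there. Every allowed movement contributes a positive entry because a
  green split is right-continuous and hence constant on each half-open interval between
  consecutive switching instants.
\<close>

section \<open>Metzler matrices with nonpositive column sums\<close>

text \<open>Pairs run from column to row: a positive entry \<open>(p, q)\<close> is flow out of cell
  \<open>q\<close> into cell \<open>p\<close>, so the transitive closure follows vehicles
  downstream.\<close>

definition pos_entries :: "real mat \<Rightarrow> (nat \<times> nat) set" where
  "pos_entries M = {(q, p). q < dim_col M \<and> p < dim_row M \<and> p \<noteq> q \<and> M $$ (p, q) > 0}"

text \<open>A singular matrix has a singular transpose, whose kernel supplies the vector. Left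
  eigenvectors are the ones whose equations involve the columns, where the sums are
  controlled.\<close>

lemma left_eigenvector_exists:
  fixes A :: "'a :: field mat"
  assumes A: "A \<in> carrier_mat n n" and det: "det (z \<cdot>\<^sub>m 1\<^sub>m n - A) = 0"
  shows "\<exists>w. (\<exists>p<n. w p \<noteq> 0) \<and> (\<forall>q<n. (\<Sum>p<n. w p * A $$ (p, q)) = z * w q)"
proof -
  let ?B = "z \<cdot>\<^sub>m 1\<^sub>m n - A"
  have B: "?B \<in> carrier_mat n n" using A by auto
  then have "det (transpose_mat ?B) = 0" using det det_transpose by metis
  then obtain v where v: "v \<in> carrier_vec n" "v \<noteq> 0\<^sub>v n" "transpose_mat ?B *\<^sub>v v = 0\<^sub>v n"
    using det_0_iff_vec_prod_zero[of "transpose_mat ?B" n] B by auto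
  obtain p where p: "p < n" "v $ p \<noteq> 0"
    using v(1,2) by (metis carrier_vecD eq_vecI index_zero_vec(1,2))
  have "(\<Sum>p<n. v $ p * A $$ (p, q)) = z * v $ q" if q: "q < n" for q
  proof -
    have "0 = (transpose_mat ?B *\<^sub>v v) $ q" using v(3) q by simp
    also have "\<dots> = (\<Sum>p<n. ?B $$ (p, q) * v $ p)"
      using B A q v(1) by (simp add: scalar_prod_def lessThan_atLeast0)
    also have "\<dots> = (\<Sum>p<n. (if p = q then z * v $ p else 0) - v $ p * A $$ (p, q))"
      by (rule sum.cong) (use A q in \<open>auto simp: left_diff_distrib right_diff_distrib mult.commute\<close>)
    also have "\<dots> = z * v $ q - (\<Sum>p<n. v $ p * A $$ (p, q))"
      using q by (simp add: sum_subtractf sum.delta)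
    finally show ?thesis by simp
  qed
  then show ?thesis using p by (intro exI[of _ "($) v"]) blast
qed

text \<open>This is the equality case of the Gershgorin bound for columns. Moving the diagonal term
  to the other side and taking moduli forces \<open>Re z\<close> below the column sum, and
  \<open>Re z \<ge> 0\<close> then leaves no slack anywhere.\<close>

lemma metzler_column_max:
  fixes M :: "nat \<Rightarrow> nat \<Rightarrow> real" and w :: "nat \<Rightarrow> complex"
  assumes q: "q < n" and nonneg: "\<And>p. p < n \<Longrightarrow> p \<noteq> q \<Longrightarrow> 0 \<le> M p q"
    and col: "(\<Sum>p<n. M p q) \<le> 0"
    and eig: "(\<Sum>p<n. w p * complex_of_real (M p q)) = z * w q"
    and max: "\<And>p. p < n \<Longrightarrow> cmod (w p) \<le> cmod (w q)" and nz: "w q \<noteq> 0" and z: "Re z \<ge> 0"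
  shows "(\<Sum>p<n. M p q) = 0"
    and "\<And>p. p < n \<Longrightarrow> p \<noteq> q \<Longrightarrow> M p q > 0 \<Longrightarrow> cmod (w p) = cmod (w q)"
proof -
  define R V where "R = {..<n} - {q}" and "V = cmod (w q)"
  have V: "V > 0" using nz by (simp add: V_def)
  have R: "finite R" "{..<n} = insert q R" "q \<notin> R" using q by (auto simp: R_def)
  have colR: "(\<Sum>p<n. M p q) = M q q + (\<Sum>p\<in>R. M p q)" using R by simp
  have "(z - M q q) * w q = (\<Sum>p\<in>R. w p * complex_of_real (M p q))"
    using eig R by (simp add: algebra_simps)
  then have "cmod (z - M q q) * V \<le> (\<Sum>p\<in>R. cmod (w p * complex_of_real (M p q)))"
    unfolding V_def norm_mult[symmetric] by (simp add: norm_sum)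
  also have "\<dots> = (\<Sum>p\<in>R. cmod (w p) * M p q)"
    by (rule sum.cong) (use nonneg in \<open>auto simp: norm_mult R_def\<close>)
  finally have le: "cmod (z - M q q) * V \<le> (\<Sum>p\<in>R. cmod (w p) * M p q)" .
  \<comment> \<open>Bounding the modulus below by the real part is valid whatever the sign of the
    diagonal entry.\<close>
  have "Re z - M q q \<le> cmod (z - M q q)" using complex_Re_le_cmod[of "z - M q q"] by simp
  then have "(Re z - M q q) * V \<le> (\<Sum>p\<in>R. cmod (w p) * M p q)"
    using le V by (meson mult_right_mono less_imp_le order_trans)
  moreover have "(\<Sum>p\<in>R. (V - cmod (w p)) * M p q)
      = V * (\<Sum>p\<in>R. M p q) - (\<Sum>p\<in>R. cmod (w p) * M p q)"
    by (simp add: left_diff_distrib sum_subtractf sum_distrib_left)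
  \<comment> \<open>The left side collects the deficits \<open>V - cmod (w p)\<close> with
    nonnegative coefficients, the right side is nonpositive. Hence both vanish, and so does every
    single term.\<close>
  ultimately have gap: "(\<Sum>p\<in>R. (V - cmod (w p)) * M p q) \<le> V * ((\<Sum>p<n. M p q) - Re z)"
    unfolding colR by (simp add: algebra_simps)
  have terms: "0 \<le> (V - cmod (w p)) * M p q" if "p \<in> R" for p
    using that max nonneg by (auto simp: V_def R_def)
  then have "0 \<le> (\<Sum>p\<in>R. (V - cmod (w p)) * M p q)" by (rule sum_nonneg)
  then have "0 \<le> (\<Sum>p<n. M p q) - Re z"
    using gap V by (meson order_trans zero_le_mult_iff not_le)
  then show c0: "(\<Sum>p<n. M p q) = 0" using col z by linarith
  have "V * ((\<Sum>p<n. M p q) - Re z) \<le> 0" unfolding c0 using V z by simp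
  then have "(\<Sum>p\<in>R. (V - cmod (w p)) * M p q) = 0"
    using gap \<open>0 \<le> (\<Sum>p\<in>R. (V - cmod (w p)) * M p q)\<close> by linarith
  then have zero: "(V - cmod (w p)) * M p q = 0" if "p \<in> R" for p
    using sum_nonneg_eq_0_iff[OF R(1), of "\<lambda>p. (V - cmod (w p)) * M p q"] terms that by blast
  show "cmod (w p) = cmod (w q)" if "p < n" "p \<noteq> q" "M p q > 0" for p
    using zero[of p] that by (auto simp: R_def V_def)
qed

text \<open>Columns are weakly diagonally dominant, and from every index a chain of positive entries
  leads to a strictly dominant column. Maximal modulus is inherited along the chain and contradicts
  strictness at its end.\<close>

lemma metzler_eigenvalue_Re_neg:
  fixes M :: "real mat"
  assumes M: "M \<in> carrier_mat n n"
    and nonneg: "\<And>p q. p < n \<Longrightarrow> q < n \<Longrightarrow> p \<noteq> q \<Longrightarrow> 0 \<le> M $$ (p, q)"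
    and col: "\<And>q. q < n \<Longrightarrow> (\<Sum>p<n. M $$ (p, q)) \<le> 0"
    and reach: "\<And>q. q < n \<Longrightarrow> \<exists>p. (q, p) \<in> (pos_entries M)\<^sup>* \<and> (\<Sum>r<n. M $$ (r, p)) < 0"
    and det: "det (z \<cdot>\<^sub>m 1\<^sub>m n - map_mat complex_of_real M) = 0"
  shows "Re z < 0"
proof (rule ccontr)
  assume "\<not> Re z < 0"
  then have z: "Re z \<ge> 0" by simp
  have cM: "map_mat complex_of_real M \<in> carrier_mat n n" using M by simp
  obtain p0 w where p0: "p0 < n" "w p0 \<noteq> 0"
    and eig': "\<And>q. q < n \<Longrightarrow> (\<Sum>p<n. w p * map_mat complex_of_real M $$ (p, q)) = z * w q"
    using left_eigenvector_exists[OF cM det] by blast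
  have eig: "(\<Sum>p<n. w p * complex_of_real (M $$ (p, q))) = z * w q" if "q < n" for q
    unfolding eig'[OF that, symmetric] by (rule sum.cong) (use M that in auto)
  define V where "V = Max ((\<lambda>p. cmod (w p)) ` {..<n})"
  have le: "cmod (w p) \<le> V" if "p < n" for p unfolding V_def using that by simp
  have V: "V > 0" using le[OF p0(1)] p0(2) by (meson less_le_trans zero_less_norm_iff)
  have "V \<in> (\<lambda>p. cmod (w p)) ` {..<n}" unfolding V_def using p0(1) by (intro Max_in) auto
  then obtain q where q: "q < n" "cmod (w q) = V" by auto
  \<comment> \<open>Stated for every index of maximal modulus, so that it can be iterated in the
    induction along a chain.\<close>
  have step: "(\<Sum>p<n. M $$ (p, q)) = 0"
      "\<And>p. p < n \<Longrightarrow> p \<noteq> q \<Longrightarrow> M $$ (p, q) > 0 \<Longrightarrow> cmod (w p) = V"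
    if q: "q < n" "cmod (w q) = V" for q
  proof -
    have "\<And>p. p < n \<Longrightarrow> cmod (w p) \<le> cmod (w q)" "w q \<noteq> 0" using le V q(2) by auto
    from metzler_column_max[of q n "\<lambda>p q. M $$ (p, q)", OF q(1) nonneg[OF _ q(1)] col[OF q(1)]
        eig[OF q(1)] this z]
    show "(\<Sum>p<n. M $$ (p, q)) = 0"
      "\<And>p. p < n \<Longrightarrow> p \<noteq> q \<Longrightarrow> M $$ (p, q) > 0 \<Longrightarrow> cmod (w p) = V"
      unfolding q(2) by blast+
  qed
  obtain p where p: "(q, p) \<in> (pos_entries M)\<^sup>*" "(\<Sum>r<n. M $$ (r, p)) < 0" using reach q by blast
  from p(1) have "p < n \<and> cmod (w p) = V"
    by induction (use q M step(2) in \<open>auto simp: pos_entries_def\<close>)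
  then show False using step(1) p(2) by force
qed

text \<open>Negativity of all real parts passes to the supremum because the spectrum is finite and,
  for positive dimension, nonempty: the supremum is attained.\<close>

lemma spectral_abscissa_neg:
  assumes M: "M \<in> carrier_mat n n" and n: "n > 0"
    and neg: "\<And>z. det (z \<cdot>\<^sub>m 1\<^sub>m n - map_mat complex_of_real M) = 0 \<Longrightarrow> Re z < 0"
  shows "spectral_abscissa M < 0"
proof -
  let ?A = "map_mat complex_of_real M"
  have A: "?A \<in> carrier_mat n n" using M by simp
  have "det (z \<cdot>\<^sub>m 1\<^sub>m n - ?A) = 0 \<longleftrightarrow> z \<in> spectrum ?A" for z
  proof -
    \<comment> \<open>\<open>char_matrix\<close> has the opposite sign convention; negation does not
      affect singularity.\<close>
    have "z \<cdot>\<^sub>m 1\<^sub>m n - ?A = - char_matrix ?A z"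
      by (rule eq_matI) (use M in \<open>auto simp: char_matrix_def\<close>)
    then show ?thesis
      unfolding spectrum_def mem_Collect_eq eigenvalue_det[OF A]
      using det_0_negate[of "char_matrix ?A z" n] A by simp
  qed
  then have eq: "{Re z | z. det (z \<cdot>\<^sub>m 1\<^sub>m (dim_row M) - ?A) = 0} = Re ` spectrum ?A"
    and negS: "\<And>z. z \<in> spectrum ?A \<Longrightarrow> Re z < 0"
    using M neg by auto
  have fin: "finite (Re ` spectrum ?A)" and ne: "Re ` spectrum ?A \<noteq> {}"
    using card_finite_spectrum(1)[OF A] spectrum_non_empty[OF A n] by auto
  have "Sup (Re ` spectrum ?A) = Max (Re ` spectrum ?A)" using fin ne by (rule cSup_eq_Max)
  also have "\<dots> < 0" using fin ne negS by auto
  finally show ?thesis unfolding spectral_abscissa_def eq .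
qed

section \<open>Entries and column sums of the network matrix\<close>

lemma sum_cells:
  "(\<Sum>p<offset N n. f p) = (\<Sum>i<n. \<Sum>a<cells N i. f (offset N i + a))"
proof (induction n)
  case (Suc n)
  have "(\<Sum>p<offset N (Suc n). f p) =
      (\<Sum>p<offset N n. f p) + (\<Sum>p=offset N n..<offset N n + cells N n. f p)"
    by (simp add: offset_def lessThan_atLeast0 sum.atLeastLessThan_concat)
  also have "(\<Sum>p=offset N n..<offset N n + cells N n. f p) = (\<Sum>a<cells N n. f (offset N n + a))"
    using sum.shift_bounds_nat_ivl[of f 0 "offset N n" "cells N n"]
    by (simp add: lessThan_atLeast0 add.commute)
  finally show ?case using Suc by simp
qed (simp add: offset_def)

text \<open>Complements \<open>cell_layout\<close>: writing each index as offset plus cell avoids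
  reasoning about the definite description in \<open>road_of\<close>.\<close>

lemma cell_cases:
  assumes "p < net_dim N"
  obtains i a where "i < num_roads N" "a < cells N i" "p = offset N i + a"
proof -
  have "\<exists>i<n. \<exists>a<cells N i. p = offset N i + a" if "p < offset N n" for n
    using that
  proof (induction n)
    case (Suc n)
    show ?case
    proof (cases "p < offset N n")
      case False
      then have "p - offset N n < cells N n" "p = offset N n + (p - offset N n)"
        using Suc.prems by (auto simp: offset_def)
      then show ?thesis by blast
    qed (use Suc.IH less_Suc_eq in blast)
  qed (simp add: offset_def)
  from this[of "num_roads N"] show ?thesis using assms that by (auto simp: offset_def net_dim_def)
qed

lemma cells_pos:
  assumes "traffic_network N" "i \<in> roads N"
  shows "cells N i > 0"
  using assms by (simp add: traffic_network_def cells_def)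

lemma net_dim_pos:
  assumes "traffic_network N"
  shows "net_dim N > 0"
proof -
  have "0 < num_roads N" using assms by (simp add: traffic_network_def)
  then show ?thesis using cells_pos[OF assms, of 0] cell_layout(3)[of 0 N 0] by (simp add: roads_def)
qed

lemma net_matrix_cell:
  assumes "i < num_roads N" "a < cells N i" "k < num_roads N" "b < cells N k"
  shows "net_matrix N t $$ (offset N i + a, offset N k + b) = net_block N t i k $$ (a, b)"
  using cell_layout[OF assms(1,2)] cell_layout[OF assms(3,4)] by (simp add: net_matrix_def)

lemma net_block_offdiag:
  assumes "i \<noteq> k" "a < cells N i" "b < cells N k"
  shows "net_block N t i k $$ (a, b) =
    (if a = 0 \<and> b = cells N k - 1 then split N i k t * rate N i k else 0)"
  using assms by (auto simp: net_block_def outer_def)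

lemma net_block_diag:
  assumes "a < cells N i" "b < cells N i"
  shows "net_block N t i i $$ (a, b) =
    (if a = b \<and> b \<noteq> cells N i - 1 then - (speed N i / step N) else 0) +
    (if a = b + 1 then speed N i / step N else 0) -
    (if a = b \<and> b = cells N i - 1
     then (\<Sum>l\<in>roads N - {i}. split N l i t * rate N l i) + exit_rate N i else 0)"
  using assms by (auto simp: net_block_def outer_def shift_block_def)

text \<open>The sign of \<open>rate\<close> is known only on allowed movements; elsewhere the split
  makes the product vanish.\<close>

lemma flow_nonneg:
  assumes "traffic_network N" "i \<in> roads N" "k \<in> roads N"
  shows "0 \<le> split N i k t * rate N i k"
proof (cases "(i, k) \<in> movements N")
  case True
  then have "rate N i k > 0" using assms(1) by (auto simp: traffic_network_def)
  moreover have "split N i k t \<in> {0, 1}" using assms unfolding traffic_network_def by blast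
  ultimately show ?thesis by auto
next
  case False
  then show ?thesis using assms by (simp add: traffic_network_def)
qed

lemma speed_step_pos:
  assumes "traffic_network N" "i \<in> roads N"
  shows "speed N i / step N > 0"
  using assms by (simp add: traffic_network_def)

text \<open>The Metzler property: off the diagonal only inflow terms occur, namely speeds between
  successive cells and flows between roads.\<close>

lemma net_matrix_nonneg:
  assumes N: "traffic_network N" and pq: "p < net_dim N" "q < net_dim N" "p \<noteq> q"
  shows "0 \<le> net_matrix N t $$ (p, q)"
proof -
  obtain i a where i: "i < num_roads N" "a < cells N i" "p = offset N i + a"
    using cell_cases[OF pq(1)] .
  obtain k b where k: "k < num_roads N" "b < cells N k" "q = offset N k + b"
    using cell_cases[OF pq(2)] .
  have r: "i \<in> roads N" "k \<in> roads N" using i k by (simp_all add: roads_def)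
  have "0 \<le> net_block N t i k $$ (a, b)"
  proof (cases "i = k")
    case True
    then have "a \<noteq> b" using pq(3) i k by auto
    then show ?thesis
      using True i k speed_step_pos[OF N r(1)] by (simp add: net_block_diag)
  next
    case False
    then show ?thesis using i k flow_nonneg[OF N r] by (simp add: net_block_offdiag)
  qed
  then show ?thesis using i k by (simp add: net_matrix_cell)
qed

text \<open>Conservation of vehicles: whatever leaves a cell enters another one, except for the
  exogenous outflow from the last cell of a road.\<close>

lemma net_matrix_column_sum:
  assumes N: "traffic_network N" and k: "k < num_roads N" "b < cells N k"
  shows "(\<Sum>p<net_dim N. net_matrix N t $$ (p, offset N k + b)) =
    (if b = cells N k - 1 then - exit_rate N k else 0)"
proof -
  let ?g = "\<lambda>i. \<Sum>a<cells N i. net_block N t i k $$ (a, b)"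
  let ?F = "\<Sum>l\<in>roads N - {k}. split N l k t * rate N l k"
  let ?v = "speed N k / step N"
  have off: "?g i = (if b = cells N k - 1 then split N i k t * rate N i k else 0)"
    if "i \<in> roads N - {k}" for i
  proof -
    have "?g i = (\<Sum>a<cells N i. if a = 0 then
        (if b = cells N k - 1 then split N i k t * rate N i k else 0) else 0)"
      by (rule sum.cong) (use that k in \<open>auto simp: net_block_offdiag\<close>)
    then show ?thesis using cells_pos[OF N] that by (simp add: sum.delta)
  qed
  have "?g k = (\<Sum>a<cells N k. (if a = b then
        (if b = cells N k - 1 then - (?F + exit_rate N k) else - ?v) else 0)
      + (if a = b + 1 then ?v else 0))"
    by (rule sum.cong) (use k in \<open>auto simp: net_block_diag\<close>)
  \<comment> \<open>Before the last cell \<open>?v\<close> cancels \<open>- ?v\<close>; in the last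
    column the row \<open>b + 1\<close> lies outside the block.\<close>
  also have "\<dots> = (if b = cells N k - 1 then - (?F + exit_rate N k) else 0)"
    using k by (auto simp: sum.distrib sum.delta)
  finally have diag: "?g k = (if b = cells N k - 1 then - (?F + exit_rate N k) else 0)" .
  have "(\<Sum>p<net_dim N. net_matrix N t $$ (p, offset N k + b)) =
      (\<Sum>i<num_roads N. \<Sum>a<cells N i. net_matrix N t $$ (offset N i + a, offset N k + b))"
    using sum_cells[where n = "num_roads N" and N = N] by (simp add: offset_def net_dim_def)
  also have "\<dots> = (\<Sum>i\<in>roads N. ?g i)"
    unfolding roads_def by (intro sum.cong refl) (use k in \<open>simp add: net_matrix_cell\<close>)
  also have "\<dots> = ?g k + (\<Sum>i\<in>roads N - {k}. ?g i)"
    using k by (intro sum.remove) (simp_all add: roads_def)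
  \<comment> \<open>The internal outflow \<open>?F\<close> on the diagonal is exactly what the first
    cells of the other roads receive.\<close>
  also have "\<dots> = (if b = cells N k - 1 then - exit_rate N k else 0)"
    unfolding diag using off by simp
  finally show ?thesis .
qed

section \<open>Green splits between switching instants\<close>

text \<open>A discrete crossing argument, applied both to partitions of piecewise constant functions
  and to switching instants.\<close>

lemma grid_interval:
  fixes t :: "nat \<Rightarrow> 'a :: linorder"
  assumes "t 0 \<le> x" "x < t n"
  obtains j where "j < n" "t j \<le> x" "x < t (Suc j)"
proof -
  have "\<exists>j<n. t j \<le> x \<and> x < t (Suc j)"
    using assms(2)
  proof (induction n)
    case (Suc n)
    then show ?case by (cases "x < t n") (auto intro: less_SucI)
  qed (use assms(1) in simp)
  then show ?thesis using that by blast
qed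

text \<open>The constancy interval containing \<open>x\<close> is open on the right, so it contains
  a right neighbourhood of \<open>x\<close>.\<close>

lemma piecewise_constant_right:
  assumes pc: "piecewise_constant T f" and x: "0 \<le> x" "x < T"
  shows "\<forall>\<^sub>F u in at_right x. f u = f x"
proof -
  obtain t :: "nat \<Rightarrow> real" and p where t0: "t 0 = 0" and tp: "t p = T"
    and const: "\<forall>j<p. \<forall>u\<in>{t j..<t (Suc j)}. f u = f (t j)"
    using pc unfolding piecewise_constant_def by blast
  obtain j where j: "j < p" "t j \<le> x" "x < t (Suc j)"
    by (rule grid_interval[of t x p]) (use x t0 tp in auto)
  have "f u = f x" if "u \<in> {x<..<t (Suc j)}" for u
  proof -
    have "u \<in> {t j..<t (Suc j)}" "x \<in> {t j..<t (Suc j)}" using that j by simp_all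
    then show ?thesis using const j(1) by metis
  qed
  moreover have "\<forall>\<^sub>F u in at_right x. u \<in> {x<..<t (Suc j)}"
    by (rule eventually_at_right_real) (use j in simp)
  ultimately show ?thesis by (rule eventually_mono[rotated])
qed

lemma switching_instants_mono:
  assumes "switching_instants N \<tau> m" "i \<le> j" "j \<le> m"
  shows "\<tau> i \<le> \<tau> j"
  using assms(2,3)
proof (induction rule: dec_induct)
  case (step k)
  then have "\<tau> k < \<tau> (Suc k)" using assms(1) by (simp add: switching_instants_def)
  then show ?case using step by simp
qed simp

text \<open>A locally constant function on a connected set is constant. Inside the interval local
  constancy holds because no split changes there; at the left end, where a jump is possible,
  right-continuity replaces it.\<close>

lemma split_constant_between:
  assumes N: "traffic_network N" and sw: "switching_instants N \<tau> m" and j: "j < m"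
    and r: "i \<in> roads N" "k \<in> roads N" and u: "\<tau> j \<le> u" "u < \<tau> (Suc j)"
  shows "split N i k u = split N i k (\<tau> j)"
proof (rule connected_local_const[of "{\<tau> j..<\<tau> (Suc j)}" _ _ "split N i k"])
  have pc: "piecewise_constant (period N) (split N i k)"
    using N r unfolding traffic_network_def by blast
  have \<tau>: "\<tau> 0 = 0" "\<tau> m = period N" using sw by (simp_all add: switching_instants_def)
  have lo: "0 \<le> \<tau> j" using switching_instants_mono[OF sw, of 0 j] j \<tau> by simp
  have hi: "\<tau> (Suc j) \<le> period N" using switching_instants_mono[OF sw, of "Suc j" m] j \<tau> by simp
  show "\<forall>x\<in>{\<tau> j..<\<tau> (Suc j)}.
      \<forall>\<^sub>F y in at x within {\<tau> j..<\<tau> (Suc j)}. split N i k x = split N i k y"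
  proof
    fix x assume x: "x \<in> {\<tau> j..<\<tau> (Suc j)}"
    show "\<forall>\<^sub>F y in at x within {\<tau> j..<\<tau> (Suc j)}. split N i k x = split N i k y"
    proof (cases "x = \<tau> j")
      case True
      have "\<forall>\<^sub>F y in at_right x. split N i k y = split N i k x"
        by (rule piecewise_constant_right[OF pc]) (use x lo hi in auto)
      \<comment> \<open>Relative to the interval, all other points near its left end lie to the
        right.\<close>
      then have "\<forall>\<^sub>F y in at x within {\<tau> j..<\<tau> (Suc j)}. split N i k y = split N i k x"
        unfolding eventually_at_filter by (rule eventually_mono) (use True in auto)
      then show ?thesis by (rule eventually_mono) simp
    next
      case False
      have "\<not> changes_at (split N i k) x"
      proof
        assume "changes_at (split N i k) x"
        \<comment> \<open>A change at \<open>x\<close>, strictly inside the period, would make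
          \<open>x\<close> a switching instant, but none lies strictly between two consecutive
          ones.\<close>
        then have "x \<in> \<tau> ` {1..<m}"
          using sw r x False lo hi unfolding switching_instants_def by auto
        then obtain l where l: "1 \<le> l" "l < m" "x = \<tau> l" by auto
        show False
        proof (cases "l \<le> j")
          case True
          then show ?thesis using switching_instants_mono[OF sw, of l j] l j x False by simp
        next
          case False
          then show ?thesis using switching_instants_mono[OF sw, of "Suc j" l] l x by simp
        qed
      qed
      then have "\<forall>\<^sub>F y in at x. split N i k y = split N i k x" by (simp add: changes_at_def)
      then have "\<forall>\<^sub>F y in at x within {\<tau> j..<\<tau> (Suc j)}. split N i k y = split N i k x"
        by (rule filter_leD[OF at_le[OF subset_UNIV]])
      then show ?thesis by (rule eventually_mono) simp
    qed
  qed
qed (use u in auto)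

text \<open>Converts a green time into a whole mode, hence a set of positive duration, during which
  the movement is active.\<close>

lemma split_active_at_switching_instant:
  assumes N: "traffic_network N" and sw: "switching_instants N \<tau> m"
    and r: "i \<in> roads N" "k \<in> roads N"
    and t: "t \<in> {0..period N}" "split N i k t \<noteq> 0"
  obtains j where "j < m" "split N i k (\<tau> j) = 1"
proof -
  have \<tau>: "\<tau> 0 = 0" "\<tau> m = period N" using sw by (simp_all add: switching_instants_def)
  have T: "period N > 0" using N by (simp add: traffic_network_def)
  have per: "split N i k (0 + period N) = split N i k 0"
    using N r unfolding traffic_network_def by blast
  \<comment> \<open>The end of the period lies in no half-open interval of the grid; periodicity
    moves it to 0.\<close>
  define u where "u = (if t = period N then 0 else t)"
  have u: "0 \<le> u" "u < \<tau> m" "split N i k u \<noteq> 0" using t T per \<tau> by (auto simp: u_def)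
  obtain j where j: "j < m" "\<tau> j \<le> u" "u < \<tau> (Suc j)"
    by (rule grid_interval[of \<tau> u m]) (use u \<tau> in auto)
  have "split N i k (\<tau> j) \<noteq> 0" using split_constant_between[OF N sw j(1) r j(2,3)] u(3) by simp
  moreover have "split N i k (\<tau> j) \<in> {0, 1}" using N r unfolding traffic_network_def by blast
  ultimately show ?thesis using that j(1) by blast
qed

section \<open>The average matrix\<close>

text \<open>The share of the period spent in mode \<open>Suc j\<close>, whose matrix is taken at
  \<open>\<tau> j\<close>. The average becomes a convex combination indexed from 0.\<close>

definition weight :: "traffic_net \<Rightarrow> (nat \<Rightarrow> real) \<Rightarrow> nat \<Rightarrow> real" where
  "weight N \<tau> j = (\<tau> (Suc j) - \<tau> j) / period N"

lemma avg_matrix_entry: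
  assumes "p < net_dim N" "q < net_dim N"
  shows "avg_matrix N \<tau> m $$ (p, q) = (\<Sum>j<m. weight N \<tau> j * net_matrix N (\<tau> j) $$ (p, q))"
proof -
  have "(\<Sum>i=1..m. duration \<tau> i * mode N \<tau> i $$ (p, q)) =
      (\<Sum>j<m. (\<tau> (Suc j) - \<tau> j) * net_matrix N (\<tau> j) $$ (p, q))"
    using sum.atLeast1_atMost_eq[of "\<lambda>i. duration \<tau> i * mode N \<tau> i $$ (p, q)" m]
    by (simp add: duration_def mode_def)
  then show ?thesis
    using assms by (simp add: avg_matrix_def weight_def sum_divide_distrib)
qed

lemma weight_pos:
  assumes "traffic_network N" "switching_instants N \<tau> m" "j < m"
  shows "weight N \<tau> j > 0"
  using assms by (simp add: weight_def traffic_network_def switching_instants_def)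

lemma sum_weight:
  assumes "traffic_network N" "switching_instants N \<tau> m"
  shows "(\<Sum>j<m. weight N \<tau> j) = 1"
  using assms
  by (simp add: weight_def sum_divide_distrib[symmetric] sum_lessThan_telescope
      traffic_network_def switching_instants_def)

lemma avg_matrix_nonneg:
  assumes "traffic_network N" "switching_instants N \<tau> m" "p < net_dim N" "q < net_dim N" "p \<noteq> q"
  shows "0 \<le> avg_matrix N \<tau> m $$ (p, q)"
  unfolding avg_matrix_entry[OF assms(3,4)]
  using net_matrix_nonneg[OF assms(1,3-5)] weight_pos[OF assms(1,2)]
  by (intro sum_nonneg mult_nonneg_nonneg) (auto intro: less_imp_le)

text \<open>The column sums of the modes do not depend on time, so a convex combination reproduces
  them.\<close>

lemma avg_matrix_column_sum:
  assumes N: "traffic_network N" and sw: "switching_instants N \<tau> m"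
    and k: "k < num_roads N" "b < cells N k"
  shows "(\<Sum>p<net_dim N. avg_matrix N \<tau> m $$ (p, offset N k + b)) =
    (if b = cells N k - 1 then - exit_rate N k else 0)" (is "_ = ?c")
proof -
  have "(\<Sum>p<net_dim N. avg_matrix N \<tau> m $$ (p, offset N k + b)) =
      (\<Sum>p<net_dim N. \<Sum>j<m. weight N \<tau> j * net_matrix N (\<tau> j) $$ (p, offset N k + b))"
    using cell_layout(3)[OF k] by (simp add: avg_matrix_entry)
  also have "\<dots> = (\<Sum>j<m. weight N \<tau> j * (\<Sum>p<net_dim N. net_matrix N (\<tau> j) $$ (p, offset N k + b)))"
    by (subst sum.swap) (simp add: sum_distrib_left)
  also have "\<dots> = (\<Sum>j<m. weight N \<tau> j) * ?c"
    unfolding net_matrix_column_sum[OF N k] sum_distrib_right ..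
  finally show ?thesis by (simp add: sum_weight[OF N sw])
qed

lemma avg_matrix_dim: "avg_matrix N \<tau> m \<in> carrier_mat (net_dim N) (net_dim N)"
  by (simp add: avg_matrix_def)

section \<open>Reachability through positive entries of the average matrix\<close>

lemma next_cell_pos_entry:
  assumes N: "traffic_network N" and sw: "switching_instants N \<tau> m"
    and i: "i < num_roads N" "Suc b < cells N i"
  shows "(offset N i + b, offset N i + Suc b) \<in> pos_entries (avg_matrix N \<tau> m)"
proof -
  have b: "offset N i + b < net_dim N" "offset N i + Suc b < net_dim N"
    using cell_layout(3) i by (metis Suc_lessD)+
  have "net_matrix N t $$ (offset N i + Suc b, offset N i + b) = speed N i / step N" for t
    using net_matrix_cell[of i N "Suc b" i b t] i by (simp add: net_block_diag)
  then have "avg_matrix N \<tau> m $$ (offset N i + Suc b, offset N i + b) = speed N i / step N"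
    unfolding avg_matrix_entry[OF b(2,1)] by (simp only: sum_distrib_right[symmetric] sum_weight[OF N sw] mult_1)
  then show ?thesis
    using b speed_step_pos[OF N, of i] i avg_matrix_dim[of N \<tau> m] by (simp add: pos_entries_def roads_def)
qed

text \<open>The last cell of \<open>k\<close> feeds the first cell of \<open>i\<close>. This entry
  is nonnegative in all modes and positive in one of positive duration, so averaging keeps it
  positive.\<close>

lemma movement_pos_entry:
  assumes N: "traffic_network N" and sw: "switching_instants N \<tau> m"
    and mv: "(i, k) \<in> movements N" and t: "t \<in> {0..period N}" "split N i k t \<noteq> 0"
  shows "(offset N k + (cells N k - 1), offset N i) \<in> pos_entries (avg_matrix N \<tau> m)"
proof -
  obtain J where "J \<in> intersections N" "(i, k) \<in> J" using mv by (auto simp: movements_def)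
  moreover have "\<forall>J\<in>intersections N. J \<subseteq> roads N \<times> roads N"
      "\<forall>i\<in>roads N. (i, i) \<notin> movements N" "\<forall>(i, k)\<in>movements N. rate N i k > 0"
    using N unfolding traffic_network_def by satx+
  ultimately have r: "i \<in> roads N" "k \<in> roads N" "i \<noteq> k" and rate: "rate N i k > 0"
    using mv by auto
  have c: "i < num_roads N" "0 < cells N i" "k < num_roads N" "cells N k - 1 < cells N k"
    using cells_pos[OF N] r by (simp_all add: roads_def)
  let ?p = "offset N i" and ?q = "offset N k + (cells N k - 1)"
  have pq: "?p < net_dim N" "?q < net_dim N"
    using cell_layout(3)[OF c(1,2)] cell_layout(3)[OF c(3,4)] by simp_all
  have entry: "net_matrix N u $$ (?p, ?q) = split N i k u * rate N i k" for u
    using net_matrix_cell[OF c, of u] r c by (simp add: net_block_offdiag)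
  obtain j where j: "j < m" "split N i k (\<tau> j) = 1"
    using split_active_at_switching_instant[OF N sw r(1,2) t] .
  have "0 < (\<Sum>j<m. weight N \<tau> j * net_matrix N (\<tau> j) $$ (?p, ?q))"
    unfolding entry
  proof (rule sum_pos2[of _ j])
    show "0 < weight N \<tau> j * (split N i k (\<tau> j) * rate N i k)"
      using weight_pos[OF N sw j(1)] j(2) rate by simp
    fix l assume "l \<in> {..<m}"
    then show "0 \<le> weight N \<tau> l * (split N i k (\<tau> l) * rate N i k)"
      using weight_pos[OF N sw, of l] flow_nonneg[OF N r(1,2)] by simp
  qed (use j in simp_all)
  moreover have "?p \<noteq> ?q"
    using cell_layout(1)[OF c(1,2)] cell_layout(1)[OF c(3,4)] r(3) by auto
  ultimately show ?thesis
    using pq avg_matrix_dim[of N \<tau> m] by (simp add: pos_entries_def avg_matrix_entry)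
qed

lemma last_cell_reachable:
  assumes N: "traffic_network N" and sw: "switching_instants N \<tau> m"
    and i: "i < num_roads N" "b < cells N i"
  shows "(offset N i + b, offset N i + (cells N i - 1)) \<in> (pos_entries (avg_matrix N \<tau> m))\<^sup>*"
proof -
  have "b \<le> cells N i - 1" using i by simp
  then show ?thesis
  proof (induction rule: inc_induct)
    case (step c)
    then have "Suc c < cells N i" by simp
    from next_cell_pos_entry[OF N sw i(1) this] step.IH
    show ?case by (rule converse_rtrancl_into_rtrancl)
  qed simp
qed

text \<open>Each step of the path crosses into the first cell of the next road and then runs down
  that road to its last cell.\<close>

lemma path_reachable:
  assumes N: "traffic_network N" and sw: "switching_instants N \<tau> m"
    and active: "\<forall>(i, k)\<in>movements N. \<exists>t\<in>{0..period N}. split N i k t \<noteq> 0"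
    and path: "is_path N k xs i"
  shows "(offset N k + (cells N k - 1), offset N i + (cells N i - 1))
    \<in> (pos_entries (avg_matrix N \<tau> m))\<^sup>*"
proof -
  let ?l = "\<lambda>i. offset N i + (cells N i - 1)"
  have xs: "xs \<noteq> []" "set xs \<subseteq> roads N" "hd xs = k" "last xs = i"
    and mv: "\<And>j. Suc j < length xs \<Longrightarrow> (xs ! Suc j, xs ! j) \<in> movements N"
    using path by (auto simp: is_path_def)
  have "(?l (xs ! 0), ?l (xs ! j)) \<in> (pos_entries (avg_matrix N \<tau> m))\<^sup>*" if "j < length xs" for j
    using that
  proof (induction j)
    case (Suc j)
    have m: "(xs ! Suc j, xs ! j) \<in> movements N" using mv Suc.prems .
    have "xs ! Suc j \<in> roads N" using xs(2) nth_mem[OF Suc.prems] by blast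
    then have "(offset N (xs ! Suc j), ?l (xs ! Suc j)) \<in> (pos_entries (avg_matrix N \<tau> m))\<^sup>*"
      using last_cell_reachable[OF N sw, of "xs ! Suc j" 0] cells_pos[OF N] by (simp add: roads_def)
    moreover have "(?l (xs ! j), offset N (xs ! Suc j)) \<in> pos_entries (avg_matrix N \<tau> m)"
      using active m movement_pos_entry[OF N sw m] by blast
    ultimately show ?case using Suc by (meson Suc_lessD rtrancl.rtrancl_into_rtrancl rtrancl_trans)
  qed simp
  from this[of "length xs - 1"] show ?thesis
    using xs by (simp add: hd_conv_nth last_conv_nth)
qed

theorem theorem3:
  fixes N :: traffic_net and \<tau> :: "nat \<Rightarrow> real" and m :: nat
  assumes "traffic_network N"
    and "\<forall>k\<in>roads N. \<exists>i\<in>dests N. \<exists>xs. is_path N k xs i"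
    and "\<forall>(i, k)\<in>movements N. \<exists>t\<in>{0..period N}. split N i k t \<noteq> 0"
    and "switching_instants N \<tau> m"
  shows "spectral_abscissa (avg_matrix N \<tau> m) < 0"
proof (rule spectral_abscissa_neg[OF avg_matrix_dim net_dim_pos[OF assms(1)]],
    rule metzler_eigenvalue_Re_neg[OF avg_matrix_dim])
  note N = assms(1) and sw = assms(4)
  have exit: "0 \<le> exit_rate N i" "i \<in> dests N \<Longrightarrow> 0 < exit_rate N i" if "i \<in> roads N" for i
    using N that by (fastforce simp: traffic_network_def)+
  fix q assume q: "q < net_dim N"
  obtain k b where k: "k < num_roads N" "b < cells N k" "q = offset N k + b" using cell_cases[OF q] .
  then have kr: "k \<in> roads N" by (simp add: roads_def)
  show "(\<Sum>p<net_dim N. avg_matrix N \<tau> m $$ (p, q)) \<le> 0"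
    using avg_matrix_column_sum[OF N sw k(1,2)] k(3) exit(1)[OF kr] by simp
  obtain i xs where i: "i \<in> dests N" and path: "is_path N k xs i" using assms(2) kr by blast
  have ir: "i \<in> roads N" using N i by (auto simp: traffic_network_def)
  \<comment> \<open>The last cell of a destination road, whose column sum is minus the positive exit
    rate.\<close>
  let ?p = "offset N i + (cells N i - 1)"
  have "(q, ?p) \<in> (pos_entries (avg_matrix N \<tau> m))\<^sup>*"
    using last_cell_reachable[OF N sw k(1,2)] path_reachable[OF N sw assms(3) path] k(3)
    by (simp add: rtrancl_trans)
  moreover have "(\<Sum>r<net_dim N. avg_matrix N \<tau> m $$ (r, ?p)) < 0"
    using avg_matrix_column_sum[OF N sw, of i "cells N i - 1"] cells_pos[OF N ir] ir exit(2)[OF ir i]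
    by (simp add: roads_def)
  ultimately show "\<exists>p. (q, p) \<in> (pos_entries (avg_matrix N \<tau> m))\<^sup>* \<and>
      (\<Sum>r<net_dim N. avg_matrix N \<tau> m $$ (r, p)) < 0" by blast
qed (use avg_matrix_nonneg[OF assms(1,4)] in auto)

end
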